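(* For all $\alpha,\varepsilon>0$ the following holds for all sufficiently large $n\in\mathbb{N}$: there exists a spanning subgraph $H$ of the $n$-blow-up of $K_3$ with $\delta^*(H)\ge(\frac12-\varepsilon)n$ and $\alpha^*_2(H)<\alpha n$ such that $H$ contains no transversal $K_3$-factor.
   Context: The $n$-blow-up of $K_3$ is the complete tripartite graph with parts $V_1,V_2,V_3$, each of size $n$. For a spanning subgraph $H$ of it (with the same vertex set and the same parts), define $\delta^*(H):=\min_{1\le i<j\le 3}\delta(H[V_i,V_j])$, where $H[V_i,V_j]$ is the bipartite subgraph of $H$ induced by $V_i$ and $V_j$, and $\delta(\cdot)$ is the minimum degree. A $2$-partite hole of size $s$ in $H$ is a pair of vertex subsets $U_1,U_2$ of size $s$ lying in two distinct parts among $V_1,V_2,V_3$ such that $H$ has no edge between $U_1$ and $U_2$. $\alpha^*_2(H)$ is the size $s$ of the largest $2$-partite hole in $H$. A subgraph of $H$ is transversal if it intersects each part in exactly one vertex. A transversal $K_3$-factor of $H$ is a collection of vertex-disjoint transversal triangles in $H$ that together cover every vertex of $H$. *)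

theory Defs
  imports Complex_Main
begin

record 'a graph =
  verts :: "'a set"
  edges :: "'a set set"

definition subgraph :: "'a graph \<Rightarrow> 'a graph \<Rightarrow> bool" where
  "subgraph H G \<longleftrightarrow> verts H \<subseteq> verts G \<and> edges H \<subseteq> edges G \<and> (\<forall>e\<in>edges H. e \<subseteq> verts H)"

definition spanning_subgraph :: "'a graph \<Rightarrow> 'a graph \<Rightarrow> bool" where
  "spanning_subgraph H G \<longleftrightarrow> subgraph H G \<and> verts H = verts G"

definition degree :: "'a graph \<Rightarrow> 'a \<Rightarrow> nat" where
  "degree G v = card {u \<in> verts G. {u, v} \<in> edges G}"

text \<open>Only meaningful for finite graphs with at least one vertex.\<close>
definition min_degree :: "'a graph \<Rightarrow> nat" where
  "min_degree G = Min (degree G ` verts G)"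

definition bipartite_subgraph :: "'a graph \<Rightarrow> 'a set \<Rightarrow> 'a set \<Rightarrow> 'a graph" where
  "bipartite_subgraph H A B =
     \<lparr>verts = A \<union> B, edges = {e \<in> edges H. \<exists>a\<in>A. \<exists>b\<in>B. e = {a, b}}\<rparr>"

text \<open>In what follows, the parts of a tripartite graph are given by a family \<open>V\<close>, of which
  only the members \<open>V 1\<close>, \<open>V 2\<close>, \<open>V 3\<close> matter.\<close>

definition complete_tripartite :: "(nat \<Rightarrow> 'a set) \<Rightarrow> 'a graph" where
  "complete_tripartite V =
     \<lparr>verts = (\<Union>i\<in>{1..3}. V i),
      edges = {{u, v} | u v. \<exists>i\<in>{1..3}. \<exists>j\<in>{1..3}. i \<noteq> j \<and> u \<in> V i \<and> v \<in> V j}\<rparr>"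

definition part :: "nat \<Rightarrow> nat \<Rightarrow> (nat \<times> nat) set" where
  "part n i = {i} \<times> {..<n}"

definition blow_up_K3 :: "nat \<Rightarrow> (nat \<times> nat) graph" where
  "blow_up_K3 n = complete_tripartite (part n)"

definition delta_star :: "(nat \<Rightarrow> 'a set) \<Rightarrow> 'a graph \<Rightarrow> nat" where
  "delta_star V H =
     Min {min_degree (bipartite_subgraph H (V i) (V j)) | i j. 1 \<le> i \<and> i < j \<and> j \<le> 3}"

definition two_partite_hole ::
    "(nat \<Rightarrow> 'a set) \<Rightarrow> 'a graph \<Rightarrow> nat \<Rightarrow> 'a set \<Rightarrow> 'a set \<Rightarrow> bool" where
  "two_partite_hole V H s U1 U2 \<longleftrightarrow>
     (\<exists>i\<in>{1..3}. \<exists>j\<in>{1..3}. i \<noteq> j \<and> U1 \<subseteq> V i \<and> U2 \<subseteq> V j) \<and>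
     card U1 = s \<and> card U2 = s \<and>
     (\<forall>u\<in>U1. \<forall>v\<in>U2. {u, v} \<notin> edges H)"

text \<open>The empty sets form a hole of size 0 and no hole is larger than the parts, so the maximum
  below exists whenever the parts are finite.\<close>
definition alpha2_star :: "(nat \<Rightarrow> 'a set) \<Rightarrow> 'a graph \<Rightarrow> nat" where
  "alpha2_star V H = Max {s. \<exists>U1 U2. two_partite_hole V H s U1 U2}"

definition triangle :: "'a graph \<Rightarrow> bool" where
  "triangle T \<longleftrightarrow>
     (\<exists>a b c. a \<noteq> b \<and> a \<noteq> c \<and> b \<noteq> c \<and>
        verts T = {a, b, c} \<and> edges T = {{a, b}, {a, c}, {b, c}})"

definition transversal :: "(nat \<Rightarrow> 'a set) \<Rightarrow> 'a graph \<Rightarrow> bool" where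
  "transversal V T \<longleftrightarrow> (\<forall>i\<in>{1..3}. card (verts T \<inter> V i) = 1)"

definition transversal_K3_factor ::
    "(nat \<Rightarrow> 'a set) \<Rightarrow> 'a graph \<Rightarrow> 'a graph set \<Rightarrow> bool" where
  "transversal_K3_factor V H F \<longleftrightarrow>
     (\<forall>T\<in>F. subgraph T H \<and> triangle T \<and> transversal V T) \<and>
     pairwise (\<lambda>S T. verts S \<inter> verts T = {}) F \<and>
     (\<Union>T\<in>F. verts T) = verts H"

end

theory Submission
  imports Defs "HOL-Library.FuncSet"
begin

text \<open>Split every part into two sides of nearly equal size, where the first side has one more
  vertex in \<open>V\<^sub>1\<close> than in \<open>V\<^sub>2\<close>. Vertices on different sides are joined according to a random-like
  graph \<open>R\<close> of bounded degree which has no large bipartite hole; vertices on the same side are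
  joined unless they have a common neighbour in \<open>R\<close>. This costs only boundedly many edges per
  vertex, and every triangle lies on one side. A factor would thus cover equally many vertices
  of \<open>V\<^sub>1\<close> and of \<open>V\<^sub>2\<close> on the first side. The graph \<open>R\<close> consists of \<open>d\<close> maps
  from \<open>{..<n}\<close> to itself, found by a counting argument, without the few vertices of large
  indegree.\<close>

section \<open>Sparse graphs without large bipartite holes\<close>

lemma card_avoiding_functions:
  assumes "U \<subseteq> {..<n}" and "W \<subseteq> {..<n}"
  shows "card {f \<in> PiE ({..<n} \<times> {..<d}) (\<lambda>_. {..<n::nat}). \<forall>u\<in>U. \<forall>c<d. f (u, c) \<notin> W}
       = (n - card W) ^ (card U * d) * n ^ ((n - card U) * d)"
proof -
  let ?I = "{..<n} \<times> {..<d}"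
  let ?g = "\<lambda>(u, c::nat). if u \<in> U then {..<n} - W else {..<n}"
  have fin: "finite U" "finite W" using assms finite_subset by auto
  have "{f \<in> PiE ?I (\<lambda>_. {..<n}). \<forall>u\<in>U. \<forall>c<d. f (u, c) \<notin> W} = PiE ?I ?g"
  proof (intro set_eqI iffI)
    fix f assume "f \<in> {f \<in> PiE ?I (\<lambda>_. {..<n}). \<forall>u\<in>U. \<forall>c<d. f (u, c) \<notin> W}"
    then show "f \<in> PiE ?I ?g" by (auto simp: PiE_iff)
  next
    fix f assume f: "f \<in> PiE ?I ?g"
    have g: "f (u, c) \<in> (if u \<in> U then {..<n} - W else {..<n})" if "u < n" "c < d" for u c
      using PiE_mem[OF f, of "(u, c)"] that by simp
    then have "f (u, c) \<in> {..<n}" if "u < n" "c < d" for u c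
      using that by (metis DiffD1)
    moreover have "f (u, c) \<notin> W" if "u \<in> U" "c < d" for u c
      using g[of u c] that assms by auto
    ultimately show "f \<in> {f \<in> PiE ?I (\<lambda>_. {..<n}). \<forall>u\<in>U. \<forall>c<d. f (u, c) \<notin> W}"
      using f by (auto simp: PiE_iff)
  qed
  then have "card {f \<in> PiE ?I (\<lambda>_. {..<n}). \<forall>u\<in>U. \<forall>c<d. f (u, c) \<notin> W} = (\<Prod>i\<in>?I. card (?g i))"
    by (simp add: card_PiE)
  also have "\<dots> = (\<Prod>u<n. \<Prod>c<d. card (?g (u, c)))"
    unfolding prod.cartesian_product by (intro prod.cong) auto
  also have "\<dots> = (\<Prod>u<n. (if u \<in> U then n - card W else n) ^ d)"
    using assms fin by (intro prod.cong) (auto simp: card_Diff_subset)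
  also have "\<dots> = (\<Prod>u<n. if u \<in> U then (n - card W) ^ d else n ^ d)"
    by (intro prod.cong) auto
  also have "\<dots> = (\<Prod>u\<in>U. (n - card W) ^ d) * (\<Prod>u\<in>{..<n} - U. n ^ d)"
    using assms by (simp add: prod.If_cases Int_absorb1 Diff_eq)
  also have "\<dots> = (n - card W) ^ (card U * d) * n ^ ((n - card U) * d)"
    using assms fin by (simp add: card_Diff_subset power_mult[symmetric] mult.commute)
  finally show ?thesis .
qed

lemma hole_probability_bound:
  fixes \<beta> :: real and n d u w :: nat
  assumes "\<beta> > 0" "n > 0" "4 \<le> \<beta>\<^sup>2 * d" "\<beta> * n \<le> u" "\<beta> * n \<le> w" "u \<le> n" "w \<le> n"
  shows "real ((n - w) ^ (u * d) * n ^ ((n - u) * d)) \<le> exp (- 4) ^ n * real n ^ (n * d)"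
proof -
  have "(n - w) / n \<le> 1 - \<beta>" using assms by (simp add: field_simps of_nat_diff)
  also have "\<dots> \<le> exp (- \<beta>)" using exp_ge_add_one_self[of "- \<beta>"] by simp
  finally have "real (n - w) \<le> exp (- \<beta>) * n"
    using assms by (simp add: field_simps of_nat_diff)
  then have "real (n - w) ^ (u * d) \<le> (exp (- \<beta>) * n) ^ (u * d)" by (intro power_mono) auto
  then have "real ((n - w) ^ (u * d) * n ^ ((n - u) * d))
      \<le> (exp (- \<beta>) * n) ^ (u * d) * real n ^ ((n - u) * d)"
    by (simp add: mult_right_mono)
  also have "\<dots> = exp (- \<beta>) ^ (u * d) * real n ^ (u * d + (n - u) * d)"
    by (simp add: power_mult_distrib power_add)
  also have "u * d + (n - u) * d = n * d" using assms by (simp add: distrib_right[symmetric])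
  also have "exp (- \<beta>) ^ (u * d) = exp (- (\<beta> * u * d))"
    by (simp add: exp_of_nat_mult[symmetric] mult_ac)
  also have "exp (- (\<beta> * u * d)) * real n ^ (n * d) \<le> exp (- 4 * real n) * real n ^ (n * d)"
  proof (intro mult_right_mono)
    have "4 * real n \<le> \<beta>\<^sup>2 * d * n" using assms by (intro mult_right_mono) auto
    also have "\<dots> = \<beta> * d * (\<beta> * n)" by (simp add: power2_eq_square)
    also have "\<dots> \<le> \<beta> * d * u" using assms by (intro mult_left_mono) auto
    finally show "exp (- (\<beta> * u * d)) \<le> exp (- 4 * real n)" by (simp add: mult_ac)
  qed simp
  also have "exp (- 4 * real n) = exp (- 4) ^ n"
    by (simp add: exp_of_nat_mult[symmetric] mult_ac)
  finally show ?thesis by simp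
qed

lemma exists_expanding_function:
  fixes \<beta> :: real and n d :: nat
  assumes "\<beta> > 0" "n > 0" "4 \<le> \<beta>\<^sup>2 * d"
  obtains f where "f \<in> PiE ({..<n} \<times> {..<d}) (\<lambda>_. {..<n})"
    and "\<And>U W. U \<subseteq> {..<n} \<Longrightarrow> W \<subseteq> {..<n} \<Longrightarrow> \<beta> * n \<le> card U \<Longrightarrow> \<beta> * n \<le> card W
           \<Longrightarrow> \<exists>u\<in>U. \<exists>c<d. f (u, c) \<in> W"
proof -
  let ?F = "PiE ({..<n} \<times> {..<d}) (\<lambda>_. {..<n})"
  define P where "P = {(U, W). U \<subseteq> {..<n} \<and> W \<subseteq> {..<n} \<and> \<beta> * n \<le> card U \<and> \<beta> * n \<le> card W}"
  define B where "B = (\<lambda>(U, W). {f \<in> ?F. \<forall>u\<in>U. \<forall>c<d. f (u, c) \<notin> W})"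
  have P_sub: "P \<subseteq> Pow {..<n} \<times> Pow {..<n}" by (auto simp: P_def)
  have finP: "finite P" using P_sub by (rule finite_subset) auto
  have cardP: "card P \<le> 4 ^ n"
  proof -
    have "card P \<le> card (Pow {..<n} \<times> Pow {..<n})" using P_sub by (intro card_mono) auto
    also have "\<dots> = 4 ^ n" by (simp add: card_cartesian_product card_Pow power_mult_distrib[symmetric])
    finally show ?thesis .
  qed
  have finF: "finite ?F" by (intro finite_PiE) auto
  have B_le: "real (card (B p)) \<le> exp (- 4) ^ n * real n ^ (n * d)" if "p \<in> P" for p
  proof -
    obtain U W where p: "p = (U, W)" by force
    with that have UW: "U \<subseteq> {..<n}" "W \<subseteq> {..<n}" "\<beta> * n \<le> card U" "\<beta> * n \<le> card W"
      by (auto simp: P_def)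
    have "card U \<le> n" "card W \<le> n" using UW card_mono[of "{..<n}"] by fastforce+
    then show ?thesis
      unfolding p B_def prod.case card_avoiding_functions[OF UW(1,2)]
      using UW assms by (intro hole_probability_bound) auto
  qed
  have "real (card (\<Union> (B ` P))) \<le> (\<Sum>p\<in>P. real (card (B p)))"
    using card_UN_le[OF finP, of B] by (metis of_nat_le_iff of_nat_sum)
  also have "\<dots> \<le> real (card P) * (exp (- 4) ^ n * real n ^ (n * d))"
    using sum_bounded_above[of P "\<lambda>p. real (card (B p))"] B_le by simp
  also have "\<dots> \<le> 4 ^ n * (exp (- 4) ^ n * real n ^ (n * d))"
    using cardP by (intro mult_right_mono) (auto simp flip: of_nat_le_iff)
  also have "\<dots> = (4 * exp (- 4)) ^ n * real n ^ (n * d)" by (simp add: power_mult_distrib)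
  also have "\<dots> < 1 * real n ^ (n * d)"
  proof -
    have "4 * exp (- 4 :: real) < 1"
      using exp_ge_add_one_self[of "4::real"] by (simp add: exp_minus field_simps)
    then show ?thesis using assms by (intro mult_strict_right_mono power_less_one_iff[THEN iffD2]) auto
  qed
  also have "\<dots> = real (card ?F)" by (simp add: card_PiE card_cartesian_product)
  finally have "card (\<Union> (B ` P)) < card ?F" by simp
  then have "\<not> ?F \<subseteq> \<Union> (B ` P)"
    using finF finP card_mono[of "\<Union> (B ` P)" ?F] by (auto simp: B_def split_def)
  then obtain f where "f \<in> ?F" "f \<notin> \<Union> (B ` P)" by blast
  then show ?thesis
    by (intro that[of f]) (auto simp: B_def P_def)
qed

lemma card_heavy_fibres:
  fixes f :: "'a \<Rightarrow> 'b"
  assumes "finite I" "finite Y"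
  shows "card {y \<in> Y. K < card {i \<in> I. f i = y}} * K \<le> card I"
proof -
  let ?Z = "{y \<in> Y. K < card {i \<in> I. f i = y}}"
  have "card ?Z * K \<le> (\<Sum>y\<in>?Z. card {i \<in> I. f i = y})"
    using sum_bounded_below[of ?Z K "\<lambda>y. card {i \<in> I. f i = y}"] by auto
  also have "\<dots> = card (\<Union>y\<in>?Z. {i \<in> I. f i = y})"
    using assms by (subst card_UN_disjoint) auto
  also have "\<dots> \<le> card I" using assms by (intro card_mono) auto
  finally show ?thesis .
qed

lemma sparse_graph_without_holes:
  fixes \<beta> :: real
  assumes "\<beta> > 0"
  shows "\<exists>D. \<forall>n>0. \<exists>R :: nat \<Rightarrow> nat \<Rightarrow> bool. symp R \<and>
      (\<forall>x. finite {y. R x y} \<and> card {y. R x y} \<le> D) \<and>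
      (\<forall>U W. U \<subseteq> {..<n} \<longrightarrow> W \<subseteq> {..<n} \<longrightarrow> \<beta> * n \<le> card U \<longrightarrow> \<beta> * n \<le> card W
         \<longrightarrow> (\<exists>u\<in>U. \<exists>w\<in>W. R u w))"
proof -
  define \<gamma> where "\<gamma> = \<beta> / 2"
  have \<gamma>: "\<gamma> > 0" using assms by (simp add: \<gamma>_def)
  obtain d :: nat where d: "4 / \<gamma>\<^sup>2 \<le> d" using real_arch_simple by blast
  then have d4: "4 \<le> \<gamma>\<^sup>2 * d" using \<gamma> by (simp add: field_simps)
  obtain K0 :: nat where "d / \<gamma> \<le> K0" using real_arch_simple by blast
  define K where "K = Suc K0"
  have K: "d \<le> \<gamma> * K" "K > 0"
    using \<open>d / \<gamma> \<le> K0\<close> \<gamma> by (simp_all add: K_def field_simps)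
  show ?thesis
  proof (intro exI[of _ "d + K"] allI impI)
    fix n :: nat assume n: "n > 0"
    let ?I = "{..<n} \<times> {..<d}"
    obtain f where f: "f \<in> PiE ?I (\<lambda>_. {..<n})"
      and f_hits: "\<And>U W. U \<subseteq> {..<n} \<Longrightarrow> W \<subseteq> {..<n} \<Longrightarrow> \<gamma> * n \<le> card U \<Longrightarrow> \<gamma> * n \<le> card W
           \<Longrightarrow> \<exists>u\<in>U. \<exists>c<d. f (u, c) \<in> W"
      using exists_expanding_function[OF \<gamma> n d4] by blast
    define Z where "Z = {y \<in> {..<n}. K < card {i \<in> ?I. f i = y}}"
    define E where "E = (\<lambda>x y. x < n \<and> y < n \<and> y \<notin> Z \<and> (\<exists>c<d. f (x, c) = y))"
    have "card Z * K \<le> n * d"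
      using card_heavy_fibres[of ?I "{..<n}" K f] by (simp add: Z_def card_cartesian_product)
    then have "real (card Z) * K \<le> n * real d" by (metis of_nat_le_iff of_nat_mult)
    also have "\<dots> \<le> n * (\<gamma> * K)" using K by (intro mult_left_mono) auto
    finally have Z_le: "card Z \<le> \<gamma> * n" using K by (simp add: mult_ac)
    have out: "finite {y. E x y}" "card {y. E x y} \<le> d" for x
    proof -
      have "{y. E x y} \<subseteq> (\<lambda>c. f (x, c)) ` {..<d}" by (auto simp: E_def)
      then show "finite {y. E x y}" "card {y. E x y} \<le> d"
        using finite_surj[of "{..<d}"] surj_card_le[of "{..<d}"] by auto
    qed
    have inn: "finite {x. E x y}" "card {x. E x y} \<le> K" for y
    proof -
      show "finite {x. E x y}" by (rule finite_subset[of _ "{..<n}"]) (auto simp: E_def)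
      show "card {x. E x y} \<le> K"
      proof (cases "y < n \<and> y \<notin> Z")
        case True
        have "{x. E x y} \<subseteq> fst ` {i \<in> ?I. f i = y}" by (force simp: E_def)
        then have "card {x. E x y} \<le> card {i \<in> ?I. f i = y}" by (intro surj_card_le) auto
        also have "\<dots> \<le> K" using True by (auto simp: Z_def)
        finally show ?thesis .
      qed (auto simp: E_def)
    qed
    show "\<exists>R :: nat \<Rightarrow> nat \<Rightarrow> bool. symp R \<and>
      (\<forall>x. finite {y. R x y} \<and> card {y. R x y} \<le> d + K) \<and>
      (\<forall>U W. U \<subseteq> {..<n} \<longrightarrow> W \<subseteq> {..<n} \<longrightarrow> \<beta> * n \<le> card U \<longrightarrow> \<beta> * n \<le> card W
         \<longrightarrow> (\<exists>u\<in>U. \<exists>w\<in>W. R u w))"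
    proof (intro exI[of _ "\<lambda>x y. E x y \<or> E y x"] conjI allI impI)
      show "symp (\<lambda>x y. E x y \<or> E y x)" by (auto intro: sympI)
      fix x
      have eq: "{y. E x y \<or> E y x} = {y. E x y} \<union> {y. E y x}" by auto
      show "finite {y. E x y \<or> E y x}" unfolding eq using out inn by simp
      show "card {y. E x y \<or> E y x} \<le> d + K" unfolding eq
        using card_Un_le[of "{y. E x y}" "{y. E y x}"] out(2)[of x] inn(2)[of x] by linarith
    next
      fix U W assume *: "U \<subseteq> {..<n}" "W \<subseteq> {..<n}" "\<beta> * n \<le> card U" "\<beta> * n \<le> card W"
      have "card W - card Z \<le> card (W - Z)" by (rule diff_card_le_card_Diff) (auto simp: Z_def)
      then have "card W \<le> real (card (W - Z)) + card Z" by linarith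
      then have "\<gamma> * n \<le> card (W - Z)" using * Z_le by (simp add: \<gamma>_def field_simps)
      moreover have "\<gamma> * n \<le> card U" using * assms n by (simp add: \<gamma>_def)
      ultimately obtain u c where "u \<in> U" "c < d" "f (u, c) \<in> W - Z"
        using f_hits[of U "W - Z"] * by blast
      moreover from this have "E u (f (u, c))" using * by (auto simp: E_def)
      ultimately show "\<exists>u\<in>U. \<exists>w\<in>W. E u w \<or> E w u" by blast
    qed
  qed
qed

section \<open>Obstruction to a factor\<close>

lemma card_factor_inside:
  assumes F: "transversal_K3_factor V H F" and i: "i \<in> {1..3}" and V: "V i \<subseteq> verts H"
    and split: "\<And>T. T \<in> F \<Longrightarrow> verts T \<subseteq> A \<or> verts T \<inter> A = {}"
  shows "card (V i \<inter> A) = card {T \<in> F. verts T \<subseteq> A}"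
proof -
  have one: "card (verts T \<inter> V i) = 1" if "T \<in> F" for T
    using F i that unfolding transversal_K3_factor_def transversal_def by blast
  have disj: "S = T" if "S \<in> F" "T \<in> F" "x \<in> verts S" "x \<in> verts T" for S T x
  proof (rule ccontr)
    assume "S \<noteq> T"
    then have "verts S \<inter> verts T = {}"
      using F that(1,2) unfolding transversal_K3_factor_def by (blast dest: pairwiseD)
    then show False using that(3,4) by blast
  qed
  have cover: "\<exists>T\<in>F. x \<in> verts T" if "x \<in> V i" for x
    using F V that unfolding transversal_K3_factor_def by blast
  let ?g = "\<lambda>T. the_elem (verts T \<inter> V i)"
  have g: "verts T \<inter> V i = {?g T}" if "T \<in> F" for T
    using card_1_singletonE[OF one[OF that]] by (metis the_elem_eq)
  have "bij_betw ?g {T \<in> F. verts T \<subseteq> A} (V i \<inter> A)"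
  proof (rule bij_betw_imageI)
    show "inj_on ?g {T \<in> F. verts T \<subseteq> A}"
    proof (rule inj_onI)
      fix S T assume "S \<in> {T \<in> F. verts T \<subseteq> A}" "T \<in> {T \<in> F. verts T \<subseteq> A}" "?g S = ?g T"
      then have ST: "S \<in> F" "T \<in> F" and eq: "?g S = ?g T" by blast+
      have "?g S \<in> verts S" "?g T \<in> verts T" using g[OF ST(1)] g[OF ST(2)] by blast+
      then show "S = T" using disj[OF ST] eq by simp
    qed
    show "?g ` {T \<in> F. verts T \<subseteq> A} = V i \<inter> A"
    proof (intro equalityI subsetI)
      fix x assume "x \<in> ?g ` {T \<in> F. verts T \<subseteq> A}"
      then show "x \<in> V i \<inter> A" using g by blast
    next
      fix x assume x: "x \<in> V i \<inter> A"
      then obtain T where T: "T \<in> F" "x \<in> verts T" using cover by blast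
      then have "verts T \<subseteq> A" using split x by blast
      moreover have "x = ?g T" using g[OF T(1)] T x by blast
      ultimately show "x \<in> ?g ` {T \<in> F. verts T \<subseteq> A}" using T by blast
    qed
  qed
  then show ?thesis by (simp add: bij_betw_same_card)
qed

section \<open>The construction\<close>

definition joined :: "nat \<Rightarrow> (nat \<times> nat) set \<Rightarrow> (nat \<Rightarrow> nat \<Rightarrow> bool) \<Rightarrow> nat \<times> nat \<Rightarrow> nat \<times> nat \<Rightarrow> bool" where
  "joined n A R x y \<longleftrightarrow>
     x \<in> {1..3} \<times> {..<n} \<and> y \<in> {1..3} \<times> {..<n} \<and> fst x \<noteq> fst y \<and>
     (if x \<in> A \<longleftrightarrow> y \<in> A then \<not> (\<exists>z. R (snd x) z \<and> R z (snd y)) else R (snd x) (snd y))"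

definition two_sided_graph :: "nat \<Rightarrow> (nat \<times> nat) set \<Rightarrow> (nat \<Rightarrow> nat \<Rightarrow> bool) \<Rightarrow> (nat \<times> nat) graph" where
  "two_sided_graph n A R =
     \<lparr>verts = {1..3} \<times> {..<n}, edges = {{x, y} | x y. joined n A R x y}\<rparr>"

lemma joined_sym: "symp R \<Longrightarrow> joined n A R x y \<Longrightarrow> joined n A R y x"
  by (auto simp: joined_def dest: sympD split: if_splits)

lemma edge_two_sided_graph:
  assumes "symp R"
  shows "{x, y} \<in> edges (two_sided_graph n A R) \<longleftrightarrow> joined n A R x y"
proof
  assume "{x, y} \<in> edges (two_sided_graph n A R)"
  then obtain a b where "{x, y} = {a, b}" "joined n A R a b" by (auto simp: two_sided_graph_def)
  then show "joined n A R x y" using joined_sym[OF assms, of n A a b] by (auto simp: doubleton_eq_iff)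
qed (auto simp: two_sided_graph_def simp del: split_paired_Ex)

lemma spanning_two_sided_graph: "spanning_subgraph (two_sided_graph n A R) (blow_up_K3 n)"
proof -
  have verts: "verts (blow_up_K3 n) = {1..3} \<times> {..<n}"
    by (auto simp: blow_up_K3_def complete_tripartite_def part_def)
  have "{x, y} \<in> edges (blow_up_K3 n)" if "joined n A R x y" for x y
  proof -
    have "fst x \<in> {1..3}" "fst y \<in> {1..3}" "fst x \<noteq> fst y" "x \<in> part n (fst x)" "y \<in> part n (fst y)"
      using that by (auto simp: joined_def part_def)
    then show ?thesis unfolding blow_up_K3_def complete_tripartite_def graph.simps by blast
  qed
  moreover have "{x, y} \<subseteq> {1..3} \<times> {..<n}" if "joined n A R x y" for x y
    using that by (simp add: joined_def)
  ultimately show ?thesis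
    unfolding spanning_subgraph_def subgraph_def verts by (fastforce simp: two_sided_graph_def)
qed

lemma joined_same_side:
  assumes R: "symp R" and "joined n A R x y" "joined n A R x z" "joined n A R y z"
    and "x \<in> A \<longleftrightarrow> y \<in> A"
  shows "z \<in> A \<longleftrightarrow> x \<in> A"
proof (rule ccontr)
  assume "\<not> (z \<in> A \<longleftrightarrow> x \<in> A)"
  then have "R (snd x) (snd z)" "R (snd y) (snd z)" using assms by (auto simp: joined_def)
  then show False using assms sympD[OF R] by (auto simp: joined_def)
qed

lemma triangle_on_one_side:
  assumes R: "symp R" and T: "triangle T" "subgraph T (two_sided_graph n A R)"
  shows "verts T \<subseteq> A \<or> verts T \<inter> A = {}"
proof -
  obtain a b c where abc: "verts T = {a, b, c}" "edges T = {{a, b}, {a, c}, {b, c}}"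
    using T by (auto simp: triangle_def)
  then have "joined n A R a b" "joined n A R a c" "joined n A R b c"
    using T by (auto simp: subgraph_def edge_two_sided_graph[OF R])
  moreover from this have "joined n A R b a" "joined n A R c a" "joined n A R c b"
    using joined_sym[OF R] by blast+
  ultimately have "(a \<in> A) = (b \<in> A)" "(a \<in> A) = (c \<in> A)"
    using joined_same_side[OF R] by metis+
  then show ?thesis using abc by auto
qed

lemma two_step_neighbours:
  fixes R :: "'a \<Rightarrow> 'a \<Rightarrow> bool"
  assumes "\<And>x. finite {y. R x y} \<and> card {y. R x y} \<le> D"
  shows "finite {y. \<exists>z. R x z \<and> R z y}" "card {y. \<exists>z. R x z \<and> R z y} \<le> D * D"
proof -
  have fin: "finite {y. R x y}" and le: "card {y. R x y} \<le> D" for x using assms by blast+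
  have eq: "{y. \<exists>z. R x z \<and> R z y} = (\<Union>z\<in>{z. R x z}. {y. R z y})" by blast
  show "finite {y. \<exists>z. R x z \<and> R z y}" unfolding eq using fin by (intro finite_UN_I)
  have "card (\<Union>z\<in>{z. R x z}. {y. R z y}) \<le> (\<Sum>z\<in>{z. R x z}. card {y. R z y})"
    using fin by (rule card_UN_le)
  also have "\<dots> \<le> of_nat (card {z. R x z}) * D" using le by (intro sum_bounded_above)
  also have "\<dots> \<le> D * D" using le by (simp only: of_nat_id mult_le_mono1)
  finally show "card {y. \<exists>z. R x z \<and> R z y} \<le> D * D" unfolding eq .
qed

lemma bipartite_subgraph_commute: "bipartite_subgraph H X Y = bipartite_subgraph H Y X"
proof -
  have "(\<exists>a\<in>X. \<exists>b\<in>Y. e = {a, b}) \<longleftrightarrow> (\<exists>a\<in>Y. \<exists>b\<in>X. e = {a, b})" for e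
    by (auto simp: insert_commute)
  then show ?thesis by (simp only: bipartite_subgraph_def Un_commute)
qed

lemma degree_two_sided_graph:
  assumes R: "symp R" and D: "\<And>x. finite {y. R x y} \<and> card {y. R x y} \<le> D"
    and ij: "i \<in> {1..3}" "j \<in> {1..3}" "i \<noteq> j" and v: "v \<in> part n i"
    and side: "t \<le> card (part n j \<inter> A)" "t \<le> card (part n j - A)"
  shows "t - D * D \<le> degree (bipartite_subgraph (two_sided_graph n A R) (part n i) (part n j)) v"
    (is "_ \<le> degree ?B v")
proof -
  define N where "N = {y. \<exists>z. R (snd v) z \<and> R z y}"
  note N = two_step_neighbours[of R D "snd v", OF D, folded N_def]
  define S where "S = (if v \<in> A then part n j \<inter> A else part n j - A)"
  have "t \<le> card S" using side by (auto simp: S_def)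
  have "card ({j} \<times> N) \<le> D * D" using N by (simp add: card_cartesian_product_singleton)
  then have "t - D * D \<le> card S - card ({j} \<times> N)" using \<open>t \<le> card S\<close> by linarith
  also have "\<dots> \<le> card (S - {j} \<times> N)" using N by (intro diff_card_le_card_Diff) auto
  also have "\<dots> \<le> card {u \<in> verts ?B. {u, v} \<in> edges ?B}"
  proof (intro card_mono subsetI)
    show "finite {u \<in> verts ?B. {u, v} \<in> edges ?B}" by (auto simp: bipartite_subgraph_def part_def)
    fix u assume u: "u \<in> S - {j} \<times> N"
    then have uj: "u \<in> part n j" by (auto simp: S_def split: if_splits)
    have "joined n A R v u"
      using u v ij by (auto simp: joined_def part_def S_def N_def split: if_splits)
    then have "{u, v} \<in> edges (two_sided_graph n A R)"
      using edge_two_sided_graph[OF R] by (metis insert_commute)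
    then show "u \<in> {u \<in> verts ?B. {u, v} \<in> edges ?B}"
      using uj v by (auto simp: bipartite_subgraph_def insert_commute)
  qed
  finally show ?thesis by (simp add: degree_def)
qed

lemma delta_star_two_sided_graph:
  assumes R: "symp R" and D: "\<And>x. finite {y. R x y} \<and> card {y. R x y} \<le> D"
    and side: "\<And>j. t \<le> card (part n j \<inter> A)" "\<And>j. t \<le> card (part n j - A)" and n: "n > 0"
  shows "t - D * D \<le> delta_star (part n) (two_sided_graph n A R)"
proof -
  let ?H = "two_sided_graph n A R"
  let ?B = "\<lambda>i j. bipartite_subgraph ?H (part n i) (part n j)"
  let ?M = "{min_degree (?B i j) | i j. 1 \<le> i \<and> i < j \<and> j \<le> 3}"
  have deg: "t - D * D \<le> min_degree (?B i j)" if ij: "1 \<le> i" "i < j" "j \<le> 3" for i j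
  proof -
    have "t - D * D \<le> degree (?B i j) v" if "v \<in> part n i \<union> part n j" for v
      using that
    proof
      assume "v \<in> part n i"
      then show ?thesis using ij side by (intro degree_two_sided_graph[OF R D]) auto
    next
      assume "v \<in> part n j"
      then show ?thesis using ij side
        by (subst bipartite_subgraph_commute, intro degree_two_sided_graph[OF R D]) auto
    qed
    then show ?thesis using n
      by (subst min_degree_def, subst Min_ge_iff) (auto simp: bipartite_subgraph_def part_def)
  qed
  have "?M \<subseteq> (\<lambda>(i, j). min_degree (?B i j)) ` ({..3} \<times> {..3})" by force
  then have "finite ?M" by (rule finite_subset) auto
  moreover have "min_degree (?B 1 2) \<in> ?M" by force
  ultimately show ?thesis
    unfolding delta_star_def by (subst Min_ge_iff) (use deg in blast)+
qed

lemma majority_side: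
  assumes "finite U" "real (card U) \<ge> 2 * r"
  obtains P where "P = A \<or> P = - A" "real (card (U \<inter> P)) \<ge> r"
proof -
  have "card U = card (U \<inter> A) + card (U \<inter> - A)"
    using assms(1) by (metis Diff_eq card_Int_Diff)
  then have "real (card (U \<inter> A)) \<ge> r \<or> real (card (U \<inter> - A)) \<ge> r" using assms(2) by linarith
  then show ?thesis using that by blast
qed

lemma hole_two_sided_graph:
  fixes \<beta> :: real
  assumes R: "symp R" and D: "\<And>x. finite {y. R x y} \<and> card {y. R x y} \<le> D"
    and hits: "\<And>U W. U \<subseteq> {..<n} \<Longrightarrow> W \<subseteq> {..<n} \<Longrightarrow> \<beta> * n \<le> card U \<Longrightarrow> \<beta> * n \<le> card W
         \<Longrightarrow> \<exists>u\<in>U. \<exists>w\<in>W. R u w"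
    and large: "real (D * D) < \<beta> * n"
    and hole: "two_partite_hole (part n) (two_sided_graph n A R) s U1 U2"
  shows "real s < 2 * \<beta> * n"
proof (rule ccontr)
  assume "\<not> real s < 2 * \<beta> * n"
  then have s: "real s \<ge> 2 * (\<beta> * n)" by simp
  obtain i j where ij: "i \<in> {1..3}" "j \<in> {1..3}" "i \<noteq> j" "U1 \<subseteq> part n i" "U2 \<subseteq> part n j"
    and U: "card U1 = s" "card U2 = s"
    and none: "\<And>u v. u \<in> U1 \<Longrightarrow> v \<in> U2 \<Longrightarrow> \<not> joined n A R u v"
    using hole by (auto simp: two_partite_hole_def edge_two_sided_graph[OF R])
  have "finite (part n k)" for k by (simp add: part_def)
  then have fin: "finite U1" "finite U2" using ij finite_subset by blast+
  obtain P where P: "P = A \<or> P = - A" "real (card (U1 \<inter> P)) \<ge> \<beta> * n"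
    using majority_side[of U1 "\<beta> * n" A] fin s U by auto
  obtain Q where Q: "Q = A \<or> Q = - A" "real (card (U2 \<inter> Q)) \<ge> \<beta> * n"
    using majority_side[of U2 "\<beta> * n" A] fin s U by auto
  have inj: "inj_on snd (U1 \<inter> P)" "inj_on snd (U2 \<inter> Q)"
    using ij by (auto simp: inj_on_def part_def)
  show False
  proof (cases "P = Q")
    case True
    have "card (U1 \<inter> P) > 0" using P(2) large by (metis of_nat_0_le_iff of_nat_0_less_iff order_le_less_trans order_less_le_trans)
    then obtain u where u: "u \<in> U1 \<inter> P" by (auto simp: card_gt_0_iff)
    let ?N = "{y. \<exists>z. R (snd u) z \<and> R z y}"
    have "snd ` (U2 \<inter> Q) \<subseteq> ?N"
    proof
      fix y assume "y \<in> snd ` (U2 \<inter> Q)"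
      then obtain v where v: "v \<in> U2 \<inter> Q" "y = snd v" by blast
      then have "u \<in> A \<longleftrightarrow> v \<in> A" using u True P by auto
      then show "y \<in> ?N" using none[of u v] u v ij by (force simp: joined_def part_def)
    qed
    then have "card (snd ` (U2 \<inter> Q)) \<le> D * D"
      using two_step_neighbours[of R D "snd u", OF D] by (meson card_mono le_trans)
    then show False using Q(2) large by (simp add: card_image[OF inj(2)] del: of_nat_mult)
  next
    case False
    have "snd ` (U1 \<inter> P) \<subseteq> {..<n}" "snd ` (U2 \<inter> Q) \<subseteq> {..<n}" using ij by (auto simp: part_def)
    moreover have "\<beta> * n \<le> card (snd ` (U1 \<inter> P))" "\<beta> * n \<le> card (snd ` (U2 \<inter> Q))"
      using P Q by (simp_all add: card_image inj)
    ultimately obtain u v where uv: "u \<in> U1 \<inter> P" "v \<in> U2 \<inter> Q" "R (snd u) (snd v)"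
      using hits[of "snd ` (U1 \<inter> P)" "snd ` (U2 \<inter> Q)"] by blast
    then have "\<not> (u \<in> A \<longleftrightarrow> v \<in> A)" using False P Q by auto
    then show False using none[of u v] uv ij by (force simp: joined_def part_def)
  qed
qed

lemma alpha2_star_less:
  assumes "\<And>s U1 U2. two_partite_hole V H s U1 U2 \<Longrightarrow> real s < r"
  shows "real (alpha2_star V H) < r"
proof -
  let ?S = "{s. \<exists>U1 U2. two_partite_hole V H s U1 U2}"
  have "two_partite_hole V H 0 {} {}"
    unfolding two_partite_hole_def
    by (intro conjI bexI[of _ 1] bexI[of _ 2]) auto
  then have "?S \<noteq> {}" by blast
  moreover have "?S \<subseteq> {..nat \<lceil>r\<rceil>}" using assms by (fastforce simp: le_nat_iff le_ceiling_iff)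
  then have "finite ?S" using finite_subset by blast
  ultimately have "alpha2_star V H \<in> ?S" unfolding alpha2_star_def by (rule Max_in[rotated])
  then show ?thesis using assms by blast
qed

lemma no_factor_two_sided_graph:
  assumes R: "symp R" and ij: "i \<in> {1..3}" "j \<in> {1..3}"
    and ne: "card (part n i \<inter> A) \<noteq> card (part n j \<inter> A)"
  shows "\<not> transversal_K3_factor (part n) (two_sided_graph n A R) F"
proof
  assume F: "transversal_K3_factor (part n) (two_sided_graph n A R) F"
  then have split: "verts T \<subseteq> A \<or> verts T \<inter> A = {}" if "T \<in> F" for T
    using that triangle_on_one_side[OF R] by (auto simp: transversal_K3_factor_def)
  have "card (part n k \<inter> A) = card {T \<in> F. verts T \<subseteq> A}" if "k \<in> {1..3}" for k
  proof (rule card_factor_inside[OF F that _ split])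
    show "part n k \<subseteq> verts (two_sided_graph n A R)"
      using that by (auto simp: two_sided_graph_def part_def)
  qed
  then show False using ne ij by simp
qed

theorem corollary1p5:
  fixes \<alpha> \<epsilon> :: real
  assumes "\<alpha> > 0" and "\<epsilon> > 0"
  shows "\<exists>n\<^sub>0. \<forall>n\<ge>n\<^sub>0. \<exists>H :: (nat \<times> nat) graph.
           spanning_subgraph H (blow_up_K3 n) \<and>
           real (delta_star (part n) H) \<ge> (1 / 2 - \<epsilon>) * real n \<and>
           real (alpha2_star (part n) H) < \<alpha> * real n \<and>
           \<not> (\<exists>F. transversal_K3_factor (part n) H F)"
proof -
  define \<beta> where "\<beta> = \<alpha> / 2"
  have \<beta>: "\<beta> > 0" using assms by (simp add: \<beta>_def)
  obtain D where D: "\<forall>n>0. \<exists>R :: nat \<Rightarrow> nat \<Rightarrow> bool. symp R \<and>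
      (\<forall>x. finite {y. R x y} \<and> card {y. R x y} \<le> D) \<and>
      (\<forall>U W. U \<subseteq> {..<n} \<longrightarrow> W \<subseteq> {..<n} \<longrightarrow> \<beta> * n \<le> card U \<longrightarrow> \<beta> * n \<le> card W
         \<longrightarrow> (\<exists>u\<in>U. \<exists>w\<in>W. R u w))"
    using sparse_graph_without_holes[OF \<beta>] by (rule exE)
  obtain n1 :: nat where n1: "(D * D + 1) / \<beta> \<le> n1" using real_arch_simple by blast
  obtain n2 :: nat where n2: "(D * D + 2) / \<epsilon> \<le> n2" using real_arch_simple by blast
  show ?thesis
  proof (intro exI[of _ "max 2 (max n1 n2)"] allI impI)
    fix n :: nat assume n: "n \<ge> max 2 (max n1 n2)"
    have "n > 0" using n by simp
    from D[rule_format, OF this]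
    obtain R :: "nat \<Rightarrow> nat \<Rightarrow> bool" where R: "symp R"
      and deg: "\<And>x. finite {y. R x y} \<and> card {y. R x y} \<le> D"
      and hits: "\<And>U W. U \<subseteq> {..<n} \<Longrightarrow> W \<subseteq> {..<n} \<Longrightarrow> \<beta> * n \<le> card U \<Longrightarrow> \<beta> * n \<le> card W
         \<Longrightarrow> \<exists>u\<in>U. \<exists>w\<in>W. R u w"
      by metis
    define m where "m = n div 2"
    define a where "a = (\<lambda>i::nat. if i = 1 then m + 1 else m)"
    define A where "A = {x :: nat \<times> nat. snd x < a (fst x)}"
    have a_le: "a i \<le> n" for i using n by (auto simp: a_def m_def)
    have "part n i \<inter> A = {i} \<times> {..<a i}" "part n i - A = {i} \<times> {a i..<n}" for i
      using a_le[of i] by (auto simp: part_def A_def)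
    then have sides: "card (part n i \<inter> A) = a i" "card (part n i - A) = n - a i" for i
      by (simp_all add: card_cartesian_product_singleton)
    let ?H = "two_sided_graph n A R"
    have "m - 1 - D * D \<le> delta_star (part n) ?H"
      using n by (intro delta_star_two_sided_graph[OF R deg]) (auto simp: sides a_def m_def)
    then have "real n / 2 - 2 - D * D \<le> delta_star (part n) ?H" unfolding m_def by linarith
    moreover have "real (D * D + 2) \<le> \<epsilon> * n"
    proof -
      have "real (D * D + 2) \<le> \<epsilon> * n2" using n2 assms by (simp add: field_simps)
      also have "\<dots> \<le> \<epsilon> * n" using n assms by simp
      finally show ?thesis .
    qed
    ultimately have delta: "(1 / 2 - \<epsilon>) * real n \<le> delta_star (part n) ?H"
      by (simp add: algebra_simps)
    have "real (D * D) < \<beta> * n"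
    proof -
      have "real (D * D) < \<beta> * n1" using n1 \<beta> by (simp add: field_simps)
      also have "\<dots> \<le> \<beta> * n" using n \<beta> by simp
      finally show ?thesis .
    qed
    then have "real s < 2 * \<beta> * n" if "two_partite_hole (part n) ?H s U1 U2" for s U1 U2
      using hole_two_sided_graph[OF R deg hits _ that] by blast
    then have "real (alpha2_star (part n) ?H) < \<alpha> * n"
      by (intro alpha2_star_less) (auto simp: \<beta>_def)
    moreover have "\<not> (\<exists>F. transversal_K3_factor (part n) ?H F)"
      using no_factor_two_sided_graph[OF R, of 1 2] by (auto simp: sides a_def)
    ultimately show "\<exists>H :: (nat \<times> nat) graph.
           spanning_subgraph H (blow_up_K3 n) \<and>
           real (delta_star (part n) H) \<ge> (1 / 2 - \<epsilon>) * real n \<and>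
           real (alpha2_star (part n) H) < \<alpha> * real n \<and>
           \<not> (\<exists>F. transversal_K3_factor (part n) H F)"
      using spanning_two_sided_graph delta by blast
  qed
qed

end
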